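(* For any basic sequence $Q$ and positive integer $k$, the set $\mathscr{RN}_k(Q)$ is of the first category. Since $\mathscr{N}_k(Q)\subsetneq\mathscr{RN}_k(Q)$, the set $\mathscr{N}_k(Q)$ is also of the first category.
   Context: A basic sequence is a sequence $Q=(q_n)_{n=1}^\infty$ of integers $q_n\ge 2$; it is infinite in limit if $q_n\to\infty$. The $Q$-Cantor series expansion of $x\in\mathbb R$ is the unique expansion $x=\lfloor x\rfloor+\sum_{n=1}^\infty \frac{E_n}{q_1q_2\cdots q_n}$ with $E_n\in\{0,1,\dots,q_n-1\}$ for $n\ge1$ and $E_n\ne q_n-1$ for infinitely many $n$. For a block (finite sequence of non-negative integers) $B$, $N_n^Q(B,x)$ is the number of times $B$ occurs in the digit sequence of the $Q$-Cantor series expansion of $x$ starting at a position no greater than $n$. Put $Q_n^{(k)}=\sum_{j=1}^n \frac{1}{q_jq_{j+1}\cdots q_{j+k-1}}$. $\mathscr{RN}_k(Q)$ is the set of real $x$ that are $Q$-ratio normal of order $k$, i.e. such that for all blocks $B_1,B_2$ of length $k$, $\lim_{n\to\infty} N_n^Q(B_1,x)/N_n^Q(B_2,x)=1$. $\mathscr N_k(Q)$ is the set of real $x$ that are $Q$-normal of order $k$, i.e. such that for all blocks $B$ of length $k$, $\lim_{n\to\infty}N_n^Q(B,x)/Q_n^{(k)}=1$. A set is of the first category if it is a countable union of nowhere dense subsets of $\mathbb R$. A footnote to the theorem remarks that $\mathscr N_k(Q)$ could be empty, and that the inclusion $\mathscr{N}_k(Q)\subsetneq\mathscr{RN}_k(Q)$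 is proven elsewhere in the literature for all $Q$ that are infinite in limit.
   Formalization: The inclusion of N_k(Q) in RN_k(Q) is stated for every basic sequence Q, but its properness only for Q infinite in limit, since for bounded Q (e.g. all q_n = 2) both sets are empty and the inclusion is not proper. *)

theory Defs
  imports "HOL-Analysis.Analysis"
begin

text \<open>
  Basic sequences and digit sequences are indexed from 1, as functions on \<open>nat\<close>.
  The value \<open>q 0\<close> is never used.
\<close>

definition basic_sequence :: "(nat \<Rightarrow> nat) \<Rightarrow> bool" where
  "basic_sequence q \<longleftrightarrow> (\<forall>n\<ge>1. q n \<ge> 2)"

definition infinite_in_limit :: "(nat \<Rightarrow> nat) \<Rightarrow> bool" where
  "infinite_in_limit q \<longleftrightarrow> filterlim q at_top sequentially"

text \<open>
  The integer part of \<open>x\<close> is not among the digits; the clause \<open>E 0 = 0\<close> only fixes the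
  irrelevant value at index 0, so that the expansion is unique as a function.
\<close>

definition is_cantor_expansion :: "(nat \<Rightarrow> nat) \<Rightarrow> real \<Rightarrow> (nat \<Rightarrow> nat) \<Rightarrow> bool" where
  "is_cantor_expansion q x E \<longleftrightarrow>
     E 0 = 0 \<and>
     (\<forall>n\<ge>1. E n \<in> {0..q n - 1}) \<and>
     infinite {n. n \<ge> 1 \<and> E n \<noteq> q n - 1} \<and>
     (\<lambda>n. real (E (Suc n)) / (\<Prod>i=1..Suc n. real (q i))) sums (x - of_int \<lfloor>x\<rfloor>)"

definition cantor_digits :: "(nat \<Rightarrow> nat) \<Rightarrow> real \<Rightarrow> nat \<Rightarrow> nat" where
  "cantor_digits q x = (THE E. is_cantor_expansion q x E)"

definition block_count :: "(nat \<Rightarrow> nat) \<Rightarrow> nat \<Rightarrow> nat list \<Rightarrow> real \<Rightarrow> nat" where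
  "block_count q n B x =
     card {i \<in> {1..n}. \<forall>j<length B. cantor_digits q x (i + j) = B ! j}"

definition Q_sum :: "(nat \<Rightarrow> nat) \<Rightarrow> nat \<Rightarrow> nat \<Rightarrow> real" where
  "Q_sum q k n = (\<Sum>j=1..n. 1 / (\<Prod>i=j..<j + k. real (q i)))"

text \<open>
  If \<open>B2\<close> never occurs, the quotients below are \<open>0\<close> by the convention for division by zero,
  so they do not tend to 1, in accordance with the limit being undefined.
\<close>

definition ratio_normal_set :: "nat \<Rightarrow> (nat \<Rightarrow> nat) \<Rightarrow> real set" where
  "ratio_normal_set k q =
     {x. \<forall>B1 B2. length B1 = k \<longrightarrow> length B2 = k \<longrightarrow>
           (\<lambda>n. real (block_count q n B1 x) / real (block_count q n B2 x)) \<longlonglongrightarrow> 1}"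

definition normal_set :: "nat \<Rightarrow> (nat \<Rightarrow> nat) \<Rightarrow> real set" where
  "normal_set k q =
     {x. \<forall>B. length B = k \<longrightarrow> (\<lambda>n. real (block_count q n B x) / Q_sum q k n) \<longlonglongrightarrow> 1}"

definition nowhere_dense :: "'a::topological_space set \<Rightarrow> bool" where
  "nowhere_dense A \<longleftrightarrow> interior (closure A) = {}"

definition first_category :: "'a::topological_space set \<Rightarrow> bool" where
  "first_category A \<longleftrightarrow> (\<exists>F. countable F \<and> (\<forall>S\<in>F. nowhere_dense S) \<and> A = \<Union>F)"


text \<open>Existence and uniqueness of the expansion, which justify the definite description above.\<close>

context
  fixes q :: "nat \<Rightarrow> nat" and P :: "nat \<Rightarrow> real"
  assumes q: "basic_sequence q"
  defines "P \<equiv> \<lambda>n. \<Prod>i=1..n. real (q i)"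
begin

private lemma q_ge: "q (Suc n) \<ge> 2"
  using q by (simp add: basic_sequence_def)

private lemma P_0: "P 0 = 1" and P_Suc: "P (Suc n) = P n * real (q (Suc n))"
  by (simp_all add: P_def)

private lemma P_ge: "P n \<ge> 2 ^ n"
proof (induction n)
  case (Suc n)
  have "2 ^ n * 2 \<le> P n * real (q (Suc n))"
    using Suc q_ge[of n] by (intro mult_mono) (auto intro: order_trans[of _ "2 ^ n"])
  then show ?case by (simp add: P_Suc)
qed (simp add: P_0)

private lemma P_pos: "P n > 0"
  using P_ge[of n] by (smt (verit) zero_less_power)

private lemma inverse_P_tendsto: "(\<lambda>n. 1 / P n) \<longlonglongrightarrow> 0"
proof (rule tendsto_sandwich[OF _ _ tendsto_const])
  show "(\<lambda>n. (1/2::real) ^ n) \<longlonglongrightarrow> 0" by (rule LIMSEQ_power_zero) simp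
  show "\<forall>\<^sub>F n in sequentially. 0 \<le> 1 / P n"
    using P_pos by (simp add: less_imp_le)
  show "\<forall>\<^sub>F n in sequentially. 1 / P n \<le> (1/2) ^ n"
    using P_ge P_pos by (simp add: power_divide frac_le)
qed

private lemma expansion_exists: "\<exists>E. is_cantor_expansion q x E"
proof -
  define e where "e n = \<lfloor>x * P (Suc n)\<rfloor> - int (q (Suc n)) * \<lfloor>x * P n\<rfloor>" for n
  define f where "f n = x * P n - of_int \<lfloor>x * P n\<rfloor>" for n
  have f: "0 \<le> f n" "f n < 1" for n
    unfolding f_def by linarith+
  have f_Suc: "f (Suc n) = real (q (Suc n)) * f n - of_int (e n)" for n
    by (simp add: f_def e_def P_Suc algebra_simps)
  have e_ge: "e n \<ge> 0" for n
  proof -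
    have "real (q (Suc n)) * f n \<ge> 0" using f[of n] by simp
    then have "of_int (e n) > (-1::real)" using f_Suc[of n] f[of "Suc n"] by linarith
    then show ?thesis by linarith
  qed
  have e_less: "e n < int (q (Suc n))" for n
  proof -
    have "real (q (Suc n)) * f n < real (q (Suc n))" using f[of n] q_ge[of n] by simp
    then have "of_int (e n) < real (q (Suc n))" using f_Suc[of n] f[of "Suc n"] by linarith
    then show ?thesis by linarith
  qed
  define E where "E n = (case n of 0 \<Rightarrow> 0 | Suc m \<Rightarrow> nat (e m))" for n
  have E_Suc: "E (Suc n) = nat (e n)" for n by (simp add: E_def)
  have 1: "E n \<in> {0..q n - 1}" if "n \<ge> 1" for n
  proof -
    obtain m where "n = Suc m" using \<open>n \<ge> 1\<close> by (cases n) auto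
    then show ?thesis using e_less[of m] e_ge[of m] E_Suc[of m] by simp
  qed
  have 2: "infinite {n. n \<ge> 1 \<and> E n \<noteq> q n - 1}"
  proof
    assume "finite {n. n \<ge> 1 \<and> E n \<noteq> q n - 1}"
    then obtain N where N: "\<And>n. n \<ge> 1 \<Longrightarrow> E n \<noteq> q n - 1 \<Longrightarrow> n \<le> N"
      by (auto simp: finite_nat_set_iff_bounded_le)
    have last: "real_of_int (e n) = real (q (Suc n)) - 1" if "n \<ge> N" for n
    proof -
      have "E (Suc n) = q (Suc n) - 1" using N[of "Suc n"] that by force
      then have "e n = int (q (Suc n)) - 1" using E_Suc[of n] e_ge[of n] q_ge[of n] by linarith
      then show ?thesis by simp
    qed
    have "1 - f (N + m) \<ge> 2 ^ m * (1 - f N)" for m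
    proof (induction m)
      case (Suc m)
      have "1 - f (N + Suc m) = real (q (Suc (N + m))) * (1 - f (N + m))"
        using f_Suc[of "N + m"] last[of "N + m"] by (simp add: algebra_simps)
      moreover have "\<dots> \<ge> 2 * (1 - f (N + m))"
        using f[of "N + m"] q_ge[of "N + m"] by (intro mult_right_mono) auto
      ultimately show ?case using Suc by simp
    qed simp
    moreover obtain m where "1 / (1 - f N) < 2 ^ m"
      using real_arch_pow[of 2] by auto
    ultimately have "1 < 1 - f (N + m)"
      using f[of N] by (smt (verit) divide_less_eq)
    then show False using f[of "N + m"] by simp
  qed
  have partial: "(\<Sum>n<m. real (E (Suc n)) / P (Suc n)) = of_int \<lfloor>x * P m\<rfloor> / P m - of_int \<lfloor>x\<rfloor>" for m
  proof (induction m)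
    case (Suc m)
    have "real (E (Suc m)) / P (Suc m) = of_int \<lfloor>x * P (Suc m)\<rfloor> / P (Suc m) - of_int \<lfloor>x * P m\<rfloor> / P m"
      using e_ge[of m] P_pos[of m] q_ge[of m] unfolding E_Suc
      by (simp add: e_def P_Suc field_simps)
    then show ?case using Suc by simp
  qed (simp add: P_0)
  have "(\<lambda>m. x - f m * (1 / P m) - of_int \<lfloor>x\<rfloor>) \<longlonglongrightarrow> x - 0 - of_int \<lfloor>x\<rfloor>"
  proof (intro tendsto_diff tendsto_const)
    show "(\<lambda>m. f m * (1 / P m)) \<longlonglongrightarrow> 0"
    proof (rule tendsto_sandwich[OF _ _ tendsto_const inverse_P_tendsto])
      show "\<forall>\<^sub>F m in sequentially. 0 \<le> f m * (1 / P m)"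
        using f P_pos by (simp add: less_imp_le)
      show "\<forall>\<^sub>F m in sequentially. f m * (1 / P m) \<le> 1 / P m"
        using f P_pos by (simp add: less_imp_le divide_right_mono)
    qed
  qed
  moreover have "x - f m * (1 / P m) - of_int \<lfloor>x\<rfloor> = (\<Sum>n<m. real (E (Suc n)) / P (Suc n))" for m
    using P_pos[of m] unfolding partial f_def by (simp add: field_simps)
  ultimately have 3: "(\<lambda>n. real (E (Suc n)) / P (Suc n)) sums (x - of_int \<lfloor>x\<rfloor>)"
    by (simp add: sums_def)
  have "is_cantor_expansion q x E"
    unfolding is_cantor_expansion_def using 1 2 3 by (simp add: E_def P_def)
  then show ?thesis by blast
qed

private lemma expansion_remainder:
  assumes E: "is_cantor_expansion q x E"
  defines "r \<equiv> \<lambda>n. P n * (x - of_int \<lfloor>x\<rfloor> - (\<Sum>m<n. real (E (Suc m)) / P (Suc m)))"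
  shows "r (Suc n) = real (q (Suc n)) * r n - real (E (Suc n))" "0 \<le> r n" "r n < 1"
proof -
  let ?t = "\<lambda>m. real (E (Suc m)) / P (Suc m)"
  have E_le: "real (E (Suc m)) \<le> real (q (Suc m)) - 1" for m
  proof -
    have "\<forall>n\<ge>1. E n \<in> {0..q n - 1}"
      using E unfolding is_cantor_expansion_def by blast
    from this[rule_format, of "Suc m"] have "E (Suc m) \<le> q (Suc m) - 1" by simp
    then show ?thesis using q_ge[of m] by linarith
  qed
  have sums: "?t sums (x - of_int \<lfloor>x\<rfloor>)"
    using E unfolding is_cantor_expansion_def P_def by blast
  have rec: "r (Suc n) = real (q (Suc n)) * r n - real (E (Suc n))" for n
    using P_pos[of n] q_ge[of n] by (simp add: r_def P_Suc field_simps)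
  have nonneg: "?t m \<ge> 0" for m using P_pos[of "Suc m"] by simp
  have "(\<Sum>m<n. ?t m) \<le> x - of_int \<lfloor>x\<rfloor>" for n
    using sum_le_suminf[OF sums_summable[OF sums] finite_lessThan[of n]] nonneg
    unfolding sums_unique[OF sums] by blast
  then have r0: "r n \<ge> 0" for n using P_pos[of n] by (simp add: r_def)
  have le: "?t m \<le> 1 / P m - 1 / P (Suc m)" for m
    using E_le[of m] P_pos[of m] q_ge[of m] by (simp add: P_Suc field_simps)
  have r1: "r n \<le> 1" for n
  proof -
    have a: "(\<lambda>m. ?t (m + n)) sums (x - of_int \<lfloor>x\<rfloor> - (\<Sum>m<n. ?t m))"
      using sums by (rule sums_split_initial_segment)
    have b: "(\<lambda>m. 1 / P (m + n) - 1 / P (Suc m + n)) sums (1 / P (0 + n) - 0)"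
      by (rule telescope_sums'[of "\<lambda>m. 1 / P (m + n)"])
         (rule LIMSEQ_ignore_initial_segment[OF inverse_P_tendsto])
    have "x - of_int \<lfloor>x\<rfloor> - (\<Sum>m<n. ?t m) \<le> 1 / P n"
      using sums_le[OF _ a b] le by simp
    then show ?thesis using P_pos[of n] by (simp add: r_def field_simps)
  qed
  have "r n \<noteq> 1" for n
  proof
    assume "r n = 1"
    have "r (n + m) = 1" for m
    proof (induction m)
      case (Suc m)
      then show ?case using rec[of "n + m"] E_le[of "n + m"] r1[of "Suc (n + m)"] by simp
    qed (simp add: \<open>r n = 1\<close>)
    note one = this
    have *: "E (Suc (n + m)) = q (Suc (n + m)) - 1" for m
    proof -
      have "real (E (Suc (n + m))) = real (q (Suc (n + m))) - 1"
        using rec[of "n + m"] one[of m] one[of "Suc m"] by simp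
      then show ?thesis using q_ge[of "n + m"] by linarith
    qed
    have "{i. i \<ge> 1 \<and> E i \<noteq> q i - 1} \<subseteq> {..n}"
    proof clarify
      fix i assume i: "E i \<noteq> q i - 1"
      show "i \<le> n"
      proof (rule ccontr)
        assume "\<not> i \<le> n"
        then have "i = Suc (n + (i - Suc n))" by simp
        then show False using *[of "i - Suc n"] i by metis
      qed
    qed
    then have "finite {i. i \<ge> 1 \<and> E i \<noteq> q i - 1}" by (rule finite_subset) simp
    then show False using E unfolding is_cantor_expansion_def by blast
  qed
  then show "r (Suc n) = real (q (Suc n)) * r n - real (E (Suc n))" "0 \<le> r n" "r n < 1"
    using rec r0[of n] r1[of n] by (auto simp: less_le)
qed

private lemma expansion_unique:
  assumes E: "is_cantor_expansion q x E" and F: "is_cantor_expansion q x F"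
  shows "E = F"
proof -
  define r where "r G n = P n * (x - of_int \<lfloor>x\<rfloor> - (\<Sum>m<n. real (G (Suc m)) / P (Suc m)))"
    for G :: "nat \<Rightarrow> nat" and n
  note rE = expansion_remainder[OF E, folded r_def] and rF = expansion_remainder[OF F, folded r_def]
  have step: "E (Suc n) = F (Suc n)" if "r E n = r F n" for n
  proof -
    have "real (E (Suc n)) < real (F (Suc n)) + 1" "real (F (Suc n)) < real (E (Suc n)) + 1"
      using rE(1)[of n] rE(2,3)[of "Suc n"] rF(1)[of n] rF(2,3)[of "Suc n"] unfolding that
      by linarith+
    then show ?thesis by linarith
  qed
  have "r E n = r F n" for n
  proof (induction n)
    case (Suc n)
    then show ?case using step[OF Suc] rE(1)[of n] rF(1)[of n] by simp
  qed (simp add: r_def)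
  then have "E n = F n" for n
    using step E F by (cases n) (auto simp: is_cantor_expansion_def)
  then show ?thesis by blast
qed

lemma cantor_expansion_ex1: "\<exists>!E. is_cantor_expansion q x E"
  using expansion_exists expansion_unique by blast

lemma cantor_digits_expansion: "is_cantor_expansion q x (cantor_digits q x)"
  unfolding cantor_digits_def using cantor_expansion_ex1 by (rule theI')

end

end

theory Submission
  imports Defs
begin

text \<open>
  Every open interval contains an interval on which the digits after some position \<open>N\<close> start with
  an arbitrarily long run of zeros. There the block \<open>0\<^sup>k\<close> occurs more than twice as often as \<open>1\<^sup>k\<close>
  at a prescribed late time, so the numbers for which this never happens from time \<open>m\<close> on form a
  nowhere dense set; the ratio normal numbers are covered by countably many such sets.

  If \<open>q\<close> tends to infinity, a ratio normal number that is not normal is obtained by writing the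
  blocks of length \<open>k\<close> at sparse positions, each equally often up to a bounded error, and filling
  the gaps with the digits \<open>q n - 2\<close>, which tend to infinity and hence affect every block count only
  by a bounded amount. The counts tend to infinity, which excludes normality if \<open>Q_sum\<close> is bounded;
  if it is unbounded, sparse enough positions keep the counts too small compared with it.
\<close>

section \<open>Cantor series\<close>

definition cantor_denom :: "(nat \<Rightarrow> nat) \<Rightarrow> nat \<Rightarrow> real" where
  "cantor_denom q n = (\<Prod>i=1..n. real (q i))"

lemma cantor_denom_0 [simp]: "cantor_denom q 0 = 1"
  and cantor_denom_Suc: "cantor_denom q (Suc n) = cantor_denom q n * real (q (Suc n))"
  by (simp_all add: cantor_denom_def)

text \<open>Lets the tail of a Cantor series after position \<open>N\<close> be treated as a Cantor
  series for the shifted basic sequence.\<close>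

lemma cantor_denom_add:
  "cantor_denom q (N + n) = cantor_denom q N * cantor_denom (\<lambda>i. q (N + i)) n"
  by (induction n) (simp_all add: cantor_denom_Suc)

lemma cantor_denom_nat: "cantor_denom q n = of_int (int (\<Prod>i=1..n. q i))"
  by (simp add: cantor_denom_def)

lemma basic_sequenceD: "basic_sequence q \<Longrightarrow> 2 \<le> q (Suc n)"
  by (simp add: basic_sequence_def)

lemma basic_sequence_shift: "basic_sequence q \<Longrightarrow> basic_sequence (\<lambda>i. q (N + i))"
  by (simp add: basic_sequence_def)

lemma cantor_denom_ge:
  assumes "basic_sequence q" shows "2 ^ n \<le> cantor_denom q n"
proof (induction n)
  case (Suc n)
  have "2 ^ n * 2 \<le> cantor_denom q n * real (q (Suc n))"
    using Suc basic_sequenceD[OF assms, of n]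
    by (intro mult_mono) (auto intro: order_trans[of _ "2 ^ n"])
  then show ?case by (simp add: cantor_denom_Suc)
qed simp

lemma cantor_denom_pos:
  assumes "basic_sequence q" shows "0 < cantor_denom q n"
  using cantor_denom_ge[OF assms, of n] by (smt (verit) zero_less_power)

lemma inverse_cantor_denom_tendsto:
  assumes "basic_sequence q" shows "(\<lambda>n. 1 / cantor_denom q n) \<longlonglongrightarrow> 0"
proof (rule tendsto_sandwich[OF _ _ tendsto_const])
  show "(\<lambda>n. (1/2::real) ^ n) \<longlonglongrightarrow> 0" by (rule LIMSEQ_power_zero) simp
  show "\<forall>\<^sub>F n in sequentially. 0 \<le> 1 / cantor_denom q n"
    using cantor_denom_pos[OF assms] by (simp add: less_imp_le)
  show "\<forall>\<^sub>F n in sequentially. 1 / cantor_denom q n \<le> (1/2) ^ n"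
    using cantor_denom_ge[OF assms] cantor_denom_pos[OF assms]
    by (simp add: power_divide frac_le)
qed

text \<open>Termwise comparison with the series of maximal digits, which telescopes to 1; a single
  smaller digit makes the inequality strict.\<close>

lemma cantor_series_sums:
  assumes q: "basic_sequence q" and E: "\<And>n. 1 \<le> n \<Longrightarrow> E n \<le> q n - 1"
    and inf: "infinite {n. n \<ge> 1 \<and> E n \<noteq> q n - 1}"
  shows "\<exists>s. (\<lambda>n. real (E (Suc n)) / cantor_denom q (Suc n)) sums s \<and> 0 \<le> s \<and> s < 1"
proof -
  define t where "t n = real (E (Suc n)) / cantor_denom q (Suc n)" for n
  \<comment> \<open>The term belonging to the maximal digit \<open>q (Suc n) - 1\<close>.\<close>
  define u where "u n = 1 / cantor_denom q n - 1 / cantor_denom q (Suc n)" for n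
  note pos = cantor_denom_pos[OF q]
  have u: "u sums 1"
    using telescope_sums'[OF inverse_cantor_denom_tendsto[OF q]] by (simp add: u_def[abs_def])
  have diff: "u n - t n = (real (q (Suc n)) - 1 - real (E (Suc n))) / cantor_denom q (Suc n)" for n
    using pos[of n] basic_sequenceD[OF q, of n]
    by (simp add: u_def t_def cantor_denom_Suc field_simps)
  have Eb: "real (E (Suc n)) \<le> real (q (Suc n)) - 1" for n
    using E[of "Suc n"] basic_sequenceD[OF q, of n] by simp
  have diff0: "0 \<le> u n - t n" for n
    unfolding diff using Eb[of n] pos[of "Suc n"] by simp
  have t0: "0 \<le> t n" for n using pos[of "Suc n"] by (simp add: t_def)
  have t: "summable t"
    by (rule summable_comparison_test'[OF sums_summable[OF u], of 0]) (use t0 diff0 in auto)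
  have "{n. n \<ge> 1 \<and> E n \<noteq> q n - 1} \<noteq> {}" using inf by (metis finite.emptyI)
  then obtain i where i: "E (Suc i) \<noteq> q (Suc i) - 1"
    by (metis (mono_tags, lifting) Suc_le_D One_nat_def empty_Collect_eq)
  then have "E (Suc i) + 1 < q (Suc i)" using E[of "Suc i"] by simp
  then have "0 < u i - t i" unfolding diff using pos[of "Suc i"] by simp
  then have "0 < (\<Sum>n. u n - t n)"
    by (intro suminf_pos2[where i = i] summable_diff sums_summable[OF u] t diff0)
  also have "\<dots> = 1 - suminf t"
    using suminf_diff[OF sums_summable[OF u] t] sums_unique[OF u] by simp
  finally have "suminf t < 1" by simp
  moreover have "0 \<le> suminf t" using suminf_nonneg[OF t] t0 by blast
  ultimately show ?thesis using summable_sums[OF t] unfolding t_def by blast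
qed

text \<open>The value of the series lies in [0,1), so its integer part is 0 and the series is its
  expansion; uniqueness identifies the digits.\<close>

lemma exists_real_with_digits:
  assumes q: "basic_sequence q" and E0: "E 0 = 0" and E: "\<And>n. 1 \<le> n \<Longrightarrow> E n \<le> q n - 1"
    and inf: "infinite {n. n \<ge> 1 \<and> E n \<noteq> q n - 1}"
  shows "\<exists>x. cantor_digits q x = E"
proof -
  obtain x where x: "(\<lambda>n. real (E (Suc n)) / cantor_denom q (Suc n)) sums x" "0 \<le> x" "x < 1"
    using cantor_series_sums[OF q E inf] by blast
  then have "\<lfloor>x\<rfloor> = 0" by linarith
  then have "is_cantor_expansion q x E"
    unfolding is_cantor_expansion_def using E0 E inf x(1) by (simp add: cantor_denom_def)
  then show ?thesis
    using cantor_expansion_ex1[OF q, of x] cantor_digits_expansion[OF q, of x] by metis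
qed

section \<open>Digits as differences of floors\<close>

lemma cantor_digits_le:
  assumes "basic_sequence q" "1 \<le> n" shows "cantor_digits q x n \<le> q n - 1"
  using cantor_digits_expansion[OF assms(1), of x] assms(2)
  unfolding is_cantor_expansion_def by (meson atLeastAtMost_iff)

text \<open>Multiplying by the denominator turns the first \<open>n\<close> terms into an integer
  \<open>A n\<close>. What remains is a Cantor series for the shifted sequence, so it lies in
  [0,1).\<close>

lemma floor_mult_cantor_denom:
  assumes q: "basic_sequence q"
  shows "of_int \<lfloor>x * cantor_denom q n\<rfloor> = cantor_denom q n *
    (of_int \<lfloor>x\<rfloor> + (\<Sum>m<n. real (cantor_digits q x (Suc m)) / cantor_denom q (Suc m)))"
proof -
  define E where "E = cantor_digits q x"
  define t where "t m = real (E (Suc m)) / cantor_denom q (Suc m)" for m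
  define A where "A n = cantor_denom q n * (of_int \<lfloor>x\<rfloor> + sum t {..<n})" for n
  note pos = cantor_denom_pos[OF q]
  have exp: "is_cantor_expansion q x E"
    unfolding E_def by (rule cantor_digits_expansion[OF q])
  have t: "t sums (x - of_int \<lfloor>x\<rfloor>)"
    using exp unfolding is_cantor_expansion_def t_def cantor_denom_def by blast
  have A_Suc: "A (Suc n) = real (q (Suc n)) * A n + real (E (Suc n))" for n
    using pos[of n] basic_sequenceD[OF q, of n]
    by (simp add: A_def t_def cantor_denom_Suc field_simps)
  have A_int: "A n \<in> \<int>" for n
  proof (induction n)
    case (Suc n)
    then show ?case unfolding A_Suc by (intro Ints_add Ints_mult Ints_of_nat)
  qed (simp add: A_def)
  \<comment> \<open>Removing the first \<open>n\<close> positions leaves infinitely many non-maximal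
    digits, as the bound on the tail \<open>r\<close> requires.\<close>
  have inf: "infinite {i. 1 \<le> i \<and> E (n + i) \<noteq> q (n + i) - 1}"
  proof
    assume "finite {i. 1 \<le> i \<and> E (n + i) \<noteq> q (n + i) - 1}"
    then have "finite ({..n} \<union> (+) n ` {i. 1 \<le> i \<and> E (n + i) \<noteq> q (n + i) - 1})" by simp
    moreover have "{i. i \<ge> 1 \<and> E i \<noteq> q i - 1} \<subseteq> \<dots>"
    proof
      fix i assume i: "i \<in> {i. i \<ge> 1 \<and> E i \<noteq> q i - 1}"
      show "i \<in> {..n} \<union> (+) n ` {i. 1 \<le> i \<and> E (n + i) \<noteq> q (n + i) - 1}"
      proof (cases "i \<le> n")
        case False
        then have "i = n + (i - n)" "1 \<le> i - n" by auto
        then show ?thesis using i by (intro UnI2 image_eqI[of _ _ "i - n"]) auto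
      qed simp
    qed
    ultimately have "finite {i. i \<ge> 1 \<and> E i \<noteq> q i - 1}" by (rule rev_finite_subset)
    then show False using exp unfolding is_cantor_expansion_def by simp
  qed
  have "E (n + i) \<le> q (n + i) - 1" if "1 \<le> i" for i
    unfolding E_def using that by (intro cantor_digits_le[OF q]) simp
  from cantor_series_sums[OF basic_sequence_shift[OF q] this inf]
  obtain r where r: "(\<lambda>i. real (E (n + Suc i)) / cantor_denom (\<lambda>j. q (n + j)) (Suc i)) sums r"
    "0 \<le> r" "r < 1" by blast
  have "real (E (n + Suc i)) / cantor_denom (\<lambda>j. q (n + j)) (Suc i) = cantor_denom q n * t (i + n)" for i
    using pos[of n] cantor_denom_add[of q n "Suc i"] by (simp add: t_def add.commute)
  then have "(\<lambda>i. cantor_denom q n * t (i + n)) sums r" using r(1) by simp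
  moreover have "(\<lambda>i. cantor_denom q n * t (i + n)) sums
      (cantor_denom q n * (x - of_int \<lfloor>x\<rfloor> - sum t {..<n}))"
    by (intro sums_mult sums_split_initial_segment t)
  ultimately have "r = cantor_denom q n * (x - of_int \<lfloor>x\<rfloor> - sum t {..<n})"
    by (rule sums_unique2)
  then have "x * cantor_denom q n = A n + r" by (simp add: A_def algebra_simps)
  moreover obtain a where "A n = of_int a" using A_int[of n] by (auto elim: Ints_cases)
  ultimately have "of_int \<lfloor>x * cantor_denom q n\<rfloor> = A n" using r(2,3) by simp linarith
  then show ?thesis by (simp add: A_def t_def E_def)
qed

text \<open>Expresses a digit through two floors, so digits are constant on any interval where these
  floors are.\<close>

lemma cantor_digits_Suc_eq_floor:
  assumes q: "basic_sequence q"
  shows "int (cantor_digits q x (Suc n)) =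
    \<lfloor>x * cantor_denom q (Suc n)\<rfloor> - int (q (Suc n)) * \<lfloor>x * cantor_denom q n\<rfloor>"
proof -
  have "real_of_int (int (cantor_digits q x (Suc n))) =
    of_int (\<lfloor>x * cantor_denom q (Suc n)\<rfloor> - int (q (Suc n)) * \<lfloor>x * cantor_denom q n\<rfloor>)"
    using cantor_denom_pos[OF q, of n] basic_sequenceD[OF q, of n]
    unfolding of_int_diff of_int_mult floor_mult_cantor_denom[OF q]
    by (simp add: cantor_denom_Suc[of q n] field_simps)
  then show ?thesis by (simp only: of_int_eq_iff)
qed

section \<open>First category\<close>

text \<open>Applied to the interior of the closure: an open set that misses \<open>A\<close> also
  misses its closure.\<close>

lemma nowhere_denseI:
  assumes "\<And>U. open U \<Longrightarrow> U \<noteq> {} \<Longrightarrow> \<exists>V. open V \<and> V \<noteq> {} \<and> V \<subseteq> U \<and> V \<inter> A = {}"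
  shows "nowhere_dense A"
proof (rule ccontr)
  assume "\<not> nowhere_dense A"
  then obtain V where V: "open V" "V \<noteq> {}" "V \<subseteq> interior (closure A)" "V \<inter> A = {}"
    using assms[of "interior (closure A)"] by (auto simp: nowhere_dense_def)
  then have "V \<inter> closure A = {}" using open_Int_closure_eq_empty by blast
  then show False using V interior_subset[of "closure A"] by blast
qed

lemma nowhere_dense_subset: "nowhere_dense B \<Longrightarrow> A \<subseteq> B \<Longrightarrow> nowhere_dense A"
  unfolding nowhere_dense_def by (metis closure_mono interior_mono subset_empty)

text \<open>The definition demands equality with the union, so each member of the cover is
  intersected with \<open>A\<close>.\<close>

lemma first_category_subset:
  assumes "first_category B" "A \<subseteq> B" shows "first_category A"
proof -
  obtain F where F: "countable F" "\<And>S. S \<in> F \<Longrightarrow> nowhere_dense S" "B = \<Union>F"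
    using assms(1) by (auto simp: first_category_def)
  have "A = \<Union>((\<lambda>S. S \<inter> A) ` F)" using F(3) assms(2) by blast
  moreover have "\<forall>S\<in>(\<lambda>S. S \<inter> A) ` F. nowhere_dense S"
    using F(2) nowhere_dense_subset[OF _ Int_lower1] by auto
  ultimately show ?thesis
    unfolding first_category_def
    by (intro exI[of _ "(\<lambda>S. S \<inter> A) ` F"] conjI countable_image F(1))
qed

text \<open>Points slightly to the right of a fraction with denominator
  \<open>cantor_denom q N\<close> have zeros after position \<open>N\<close>. The order of
  quantifiers matters: \<open>N\<close> depends on \<open>U\<close> alone, so \<open>L\<close> may
  later be chosen large compared with \<open>N\<close>.\<close>

lemma exists_zero_run:
  assumes q: "basic_sequence q" and U: "open U" "U \<noteq> {}"
  shows "\<exists>N. \<forall>L. \<exists>V. open V \<and> V \<noteq> {} \<and> V \<subseteq> U \<and>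
    (\<forall>x\<in>V. \<forall>n\<in>{N<..N + L}. cantor_digits q x n = 0)"
proof -
  note pos = cantor_denom_pos[OF q]
  obtain x e where e: "0 < e" "ball x e \<subseteq> U" using U open_contains_ball by blast
  have "\<forall>\<^sub>F n in sequentially. 1 / cantor_denom q n < e / 2"
    using order_tendstoD(2)[OF inverse_cantor_denom_tendsto[OF q], of "e/2"] e by simp
  then obtain N where N: "1 / cantor_denom q N < e / 2"
    by (auto simp: eventually_sequentially)
  \<comment> \<open>\<open>y\<close> is the left end of the interval of order \<open>N\<close> that
    contains \<open>x\<close>; its length is below \<open>e / 2\<close>.\<close>
  define a where "a = \<lfloor>x * cantor_denom q N\<rfloor>"
  define y where "y = of_int a / cantor_denom q N"
  have y: "\<bar>y - x\<bar> < e / 2"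
  proof -
    have "\<bar>of_int a - x * cantor_denom q N\<bar> \<le> 1" unfolding a_def by linarith
    then have "\<bar>of_int a - x * cantor_denom q N\<bar> / cantor_denom q N \<le> 1 / cantor_denom q N"
      using pos[of N] by (intro divide_right_mono) auto
    also have "\<bar>of_int a - x * cantor_denom q N\<bar> / cantor_denom q N = \<bar>y - x\<bar>"
      using pos[of N] unfolding y_def
      by (metis abs_divide abs_of_pos diff_divide_distrib less_numeral_extra(3)
          nonzero_mult_div_cancel_right order_less_irrefl)
    finally show ?thesis using N by simp
  qed
  have "\<exists>V. open V \<and> V \<noteq> {} \<and> V \<subseteq> U \<and> (\<forall>x\<in>V. \<forall>n\<in>{N<..N + L}. cantor_digits q x n = 0)" for L
  proof -
    \<comment> \<open>The interior of the interval of order \<open>N + L\<close> with the same left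
      end \<open>y\<close>.\<close>
    define V where "V = {y<..<y + 1 / cantor_denom q (N + L)}"
    have dmono: "cantor_denom q (N + l) \<le> cantor_denom q (N + L)" if "l \<le> L" for l
    proof -
      have "1 \<le> (2::real) ^ (L - l)" by simp
      also have "\<dots> \<le> cantor_denom (\<lambda>i. q (N + l + i)) (L - l)"
        by (rule cantor_denom_ge[OF basic_sequence_shift[OF q]])
      finally show ?thesis
        using cantor_denom_add[of q "N + l" "L - l"] that pos[of "N + l"]
        by (simp add: mult_le_cancel_left1)
    qed
    have small: "1 / cantor_denom q (N + L) \<le> 1 / cantor_denom q N"
      using dmono[of 0] pos[of N] by (intro divide_left_mono) (auto intro: mult_pos_pos pos)
    have "V \<subseteq> ball x e"
    proof
      fix v assume "v \<in> V"
      then have "\<bar>v - y\<bar> < e / 2" using small N by (auto simp: V_def)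
      then show "v \<in> ball x e" using y unfolding mem_ball dist_real_def by linarith
    qed
    moreover have "V \<noteq> {}" using pos[of "N + L"] by (simp add: V_def)
    moreover have "cantor_digits q v n = 0" if v: "v \<in> V" and n: "n \<in> {N<..N + L}" for v n
    proof -
      define d where "d l = int (\<Prod>i=1..l. q (N + i))" for l
      have d: "cantor_denom (\<lambda>i. q (N + i)) l = of_int (d l)" for l
        unfolding d_def by (rule cantor_denom_nat)
      \<comment> \<open>At level \<open>N + l\<close> the scaled \<open>y\<close> is an integer, and
        the scaled \<open>v\<close> exceeds it by less than 1.\<close>
      have fl: "\<lfloor>v * cantor_denom q (N + l)\<rfloor> = a * d l" if "l \<le> L" for l
      proof -
        have eq: "y * cantor_denom q (N + l) = of_int (a * d l)"
          using pos[of N] by (simp add: y_def cantor_denom_add d)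
        have "y * cantor_denom q (N + l) < v * cantor_denom q (N + l)"
          using v pos[of "N + l"] by (simp add: V_def)
        moreover have "v * cantor_denom q (N + l) < (y + 1 / cantor_denom q (N + L)) * cantor_denom q (N + l)"
          using v pos[of "N + l"] by (simp add: V_def)
        moreover have "cantor_denom q (N + l) / cantor_denom q (N + L) \<le> 1"
          using dmono[OF that] pos[of "N + L"] by simp
        ultimately show ?thesis unfolding floor_eq_iff eq[symmetric] by (simp add: algebra_simps)
      qed
      obtain l where l: "n = Suc (N + l)" "Suc l \<le> L"
        using n by (auto dest!: less_imp_Suc_add)
      have "int (cantor_digits q v n) = a * d (Suc l) - int (q (Suc (N + l))) * (a * d l)"
        unfolding l(1) cantor_digits_Suc_eq_floor[OF q] using fl[of l] fl[of "Suc l"] l(2) by simp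
      also have "d (Suc l) = d l * int (q (Suc (N + l)))" by (simp add: d_def)
      finally show ?thesis by simp
    qed
    ultimately show ?thesis using e(2) by (intro exI[of _ V]) (auto simp: V_def)
  qed
  then show ?thesis by blast
qed

text \<open>Up to time \<open>N + L\<close> a block of ones can start only in the first
  \<open>N\<close> positions, whereas the zero run supplies more than \<open>2 * N\<close> blocks of
  zeros.\<close>

lemma nowhere_dense_zero_blocks_bounded:
  assumes q: "basic_sequence q" and k: "1 \<le> k"
  shows "nowhere_dense
    {x. \<forall>n\<ge>m. block_count q n (replicate k 0) x \<le> 2 * block_count q n (replicate k 1) x}"
    (is "nowhere_dense ?A")
proof (rule nowhere_denseI)
  fix U :: "real set" assume "open U" "U \<noteq> {}"
  from exists_zero_run[OF q this] obtain N where N: "\<And>L. \<exists>V. open V \<and> V \<noteq> {} \<and> V \<subseteq> U \<and>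
      (\<forall>x\<in>V. \<forall>n\<in>{N<..N + L}. cantor_digits q x n = 0)" by (elim exE) metis
  \<comment> \<open>The run contains \<open>L - k + 1 = 2 * N + m + 1\<close> starting positions of
    zero blocks, and the summand \<open>m\<close> makes \<open>N + L\<close> a time that is at least
    \<open>m\<close>.\<close>
  define L where "L = 2 * N + k + m"
  obtain V where V: "open V" "V \<noteq> {}" "V \<subseteq> U"
    "\<And>x n. x \<in> V \<Longrightarrow> n \<in> {N<..N + L} \<Longrightarrow> cantor_digits q x n = 0"
    using N[of L] by metis
  have "x \<notin> ?A" if x: "x \<in> V" for x
  proof
    assume "x \<in> ?A"
    then have le: "block_count q (N + L) (replicate k 0) x \<le> 2 * block_count q (N + L) (replicate k 1) x"
      by (simp add: L_def)
    have "block_count q (N + L) (replicate k 1) x \<le> card {1..N}"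
      unfolding block_count_def
    proof (intro card_mono subsetI)
      fix i assume i: "i \<in> {i \<in> {1..N + L}. \<forall>j<length (replicate k 1).
        cantor_digits q x (i + j) = replicate k 1 ! j}"
      then have "cantor_digits q x i = 1" using k by (auto dest: spec[of _ 0])
      then show "i \<in> {1..N}" using V(4)[OF x, of i] i by force
    qed simp
    moreover have "card {N<..N + L - k + 1} \<le> block_count q (N + L) (replicate k 0) x"
      unfolding block_count_def
    proof (intro card_mono subsetI)
      fix i assume "i \<in> {N<..N + L - k + 1}"
      then show "i \<in> {i \<in> {1..N + L}. \<forall>j<length (replicate k 0).
        cantor_digits q x (i + j) = replicate k 0 ! j}"
        using k by (auto simp: L_def intro!: V(4)[OF x])
    qed simp
    ultimately show False using le by (simp add: L_def)
  qed
  then show "\<exists>V. open V \<and> V \<noteq> {} \<and> V \<subseteq> U \<and> V \<inter> ?A = {}" using V by blast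
qed

lemma ratio_normal_set_first_category:
  assumes q: "basic_sequence q" and k: "1 \<le> k"
  shows "first_category (ratio_normal_set k q)"
proof -
  define A where "A m = {x. \<forall>n\<ge>m. block_count q n (replicate k 0) x \<le> 2 * block_count q n (replicate k 1) x}" for m
  have "first_category (\<Union>(range A))"
    unfolding first_category_def
    using nowhere_dense_zero_blocks_bounded[OF q k, folded A_def]
    by (intro exI[of _ "range A"]) auto
  \<comment> \<open>A quotient tending to 1 is eventually below 2, which places \<open>x\<close> in
    some \<open>A m\<close>.\<close>
  moreover have "ratio_normal_set k q \<subseteq> \<Union>(range A)"
  proof
    fix x assume "x \<in> ratio_normal_set k q"
    then have lim: "(\<lambda>n. real (block_count q n (replicate k 0) x) /
        real (block_count q n (replicate k 1) x)) \<longlonglongrightarrow> 1"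
      by (simp add: ratio_normal_set_def)
    \<comment> \<open>The lower bound excludes a zero denominator, where the quotient would be 0 by
      convention and the upper bound would say nothing.\<close>
    have "\<forall>\<^sub>F n in sequentially. 1 / 2 < real (block_count q n (replicate k 0) x) /
        real (block_count q n (replicate k 1) x)"
      using order_tendstoD(1)[OF lim, of "1/2"] by simp
    moreover have "\<forall>\<^sub>F n in sequentially. real (block_count q n (replicate k 0) x) /
        real (block_count q n (replicate k 1) x) < 2"
      using order_tendstoD(2)[OF lim, of 2] by simp
    ultimately have "\<forall>\<^sub>F n in sequentially.
        block_count q n (replicate k 0) x \<le> 2 * block_count q n (replicate k 1) x"
    proof eventually_elim
      case (elim n)
      then have "block_count q n (replicate k 1) x \<noteq> 0"
        by (metis div_by_0 of_nat_0 not_less zero_le_divide_1_iff zero_le_numeral)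
      then show ?case using elim by (simp add: field_simps)
    qed
    then show "x \<in> \<Union>(range A)" by (auto simp: A_def eventually_sequentially)
  qed
  ultimately show ?thesis by (rule first_category_subset)
qed

section \<open>Normality and ratio normality\<close>

lemma Q_sum_pos:
  assumes "basic_sequence q" "1 \<le> n" shows "0 < Q_sum q k n"
  unfolding Q_sum_def
proof (rule sum_pos)
  fix j assume "j \<in> {1..n}"
  then have "0 < real (q i)" if "i \<in> {j..<j + k}" for i
    using that assms(1) unfolding basic_sequence_def
    by (metis atLeastAtMost_iff atLeastLessThan_iff le_trans not_numeral_le_zero not_gr_zero of_nat_0_less_iff)
  then show "0 < 1 / (\<Prod>i=j..<j + k. real (q i))"
    by (intro divide_pos_pos prod_pos) auto
qed (use assms in auto)

lemma Q_sum_mono: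
  assumes "m \<le> n" shows "Q_sum q k m \<le> Q_sum q k n"
  unfolding Q_sum_def using assms by (intro sum_mono2) (auto intro!: divide_nonneg_nonneg prod_nonneg)

text \<open>Quotient of the two limits; the positive \<open>Q_sum\<close> cancels from
  \<open>n = 1\<close> on.\<close>

lemma normal_set_subset_ratio_normal_set:
  assumes q: "basic_sequence q"
  shows "normal_set k q \<subseteq> ratio_normal_set k q"
proof
  fix x assume x: "x \<in> normal_set k q"
  show "x \<in> ratio_normal_set k q"
    unfolding ratio_normal_set_def
  proof (intro CollectI allI impI)
    fix B1 B2 :: "nat list" assume B: "length B1 = k" "length B2 = k"
    let ?f = "\<lambda>B n. real (block_count q n B x) / Q_sum q k n"
    have "(\<lambda>n. ?f B1 n / ?f B2 n) \<longlonglongrightarrow> 1 / 1"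
      using x B by (intro tendsto_divide) (auto simp: normal_set_def)
    then have "(\<lambda>n. ?f B1 n / ?f B2 n) \<longlonglongrightarrow> 1" by simp
    moreover have "\<forall>\<^sub>F n in sequentially. ?f B1 n / ?f B2 n =
        real (block_count q n B1 x) / real (block_count q n B2 x)"
      using eventually_ge_at_top[of 1]
    proof eventually_elim
      case (elim n)
      then show ?case using Q_sum_pos[OF q, of n k] by simp
    qed
    ultimately show "(\<lambda>n. real (block_count q n B1 x) / real (block_count q n B2 x)) \<longlonglongrightarrow> 1"
      by (rule Lim_transform_eventually)
  qed
qed

section \<open>A ratio normal number that is not normal\<close>

lemma finite_le_strict_mono:
  fixes s :: "nat \<Rightarrow> nat"
  assumes "strict_mono s" "inj h"
  shows "finite {j. s (h j) \<le> n}"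
proof -
  have "h ` {j. s (h j) \<le> n} \<subseteq> {..n}"
    using strict_mono_imp_increasing[OF assms(1)] by (force intro: order_trans)
  then show ?thesis
    using finite_imageD[OF finite_subset[OF _ finite_atMost]] assms(2)
    by (meson inj_on_subset subset_UNIV)
qed

text \<open>
  Blocks are listed along the diagonals of \<open>\<nat> \<times> \<nat>\<close>: the \<open>m\<close>-th entry carries the index
  \<open>fst (prod_decode m)\<close>, so that any two indices have been listed equally often up to a bounded error.
\<close>

lemma card_diagonal_index_bounds:
  fixes s :: "nat \<Rightarrow> nat"
  assumes s: "strict_mono s"
  defines "c \<equiv> \<lambda>i n. card {m. fst (prod_decode m) = i \<and> s m \<le> n}"
  shows "c i n \<le> c 0 n" "c 0 n \<le> c i n + (i + 1)"
    "K \<le> c 0 (s (prod_encode (0, K)))" "c 0 (s M) \<le> M + 1"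
proof -
  define D where "D i n = {j. s (prod_encode (i, j)) \<le> n}" for i n
  have inj: "inj (\<lambda>j. prod_encode (i, j))" for i by (auto simp: inj_def)
  have fin: "finite (D i n)" for i n
    unfolding D_def by (rule finite_le_strict_mono[OF s inj])
  have "{m. fst (prod_decode m) = i \<and> s m \<le> n} = (\<lambda>j. prod_encode (i, j)) ` D i n" for i n
  proof (intro equalityI subsetI)
    fix m assume "m \<in> {m. fst (prod_decode m) = i \<and> s m \<le> n}"
    then have "m = prod_encode (i, snd (prod_decode m))" "s m \<le> n"
      by (auto simp: prod_decode_inverse dest: sym)
    then show "m \<in> (\<lambda>j. prod_encode (i, j)) ` D i n" unfolding D_def by (metis imageI mem_Collect_eq)
  qed (auto simp: D_def)
  then have c: "c i n = card (D i n)" for i n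
    unfolding c_def by (simp add: card_image inj_on_subset[OF inj])
  have le: "s a \<le> s b \<longleftrightarrow> a \<le> b" for a b using s by (rule strict_mono_less_eq)
  have tri: "triangle j \<le> triangle (i + j)" for i j
    by (induction i) auto
  \<comment> \<open>\<open>prod_encode (i, j)\<close> is \<open>triangle (i + j) + i\<close>, so the
    \<open>j\<close>-th entry of index 0 never comes after the \<open>j\<close>-th entry of index
    \<open>i\<close>.\<close>
  have "D i n \<subseteq> D 0 n"
  proof
    fix j assume "j \<in> D i n"
    moreover have "prod_encode (0, j) \<le> prod_encode (i, j)"
      using tri[of j i] by (simp add: prod_encode_def trans_le_add1)
    ultimately show "j \<in> D 0 n" unfolding D_def using le order_trans by blast
  qed
  then show "c i n \<le> c 0 n" unfolding c by (intro card_mono fin)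
  have "D 0 n \<subseteq> {..i} \<union> (\<lambda>j. j + i + 1) ` D i n"
  proof
    fix j assume j: "j \<in> D 0 n"
    show "j \<in> {..i} \<union> (\<lambda>j. j + i + 1) ` D i n"
    proof (cases "j \<le> i")
      case False
      then obtain l where l: "j = l + i + 1" by (metis add.commute add_Suc_right less_imp_Suc_add not_le Suc_eq_plus1)
      \<comment> \<open>The pair \<open>(i, l)\<close> lies on diagonal \<open>i + l\<close>, and
        \<open>(0, j)\<close> opens the next one.\<close>
      have "prod_encode (i, l) \<le> prod_encode (0, j)"
        by (simp add: l prod_encode_def add.commute)
      then have "l \<in> D i n" using j le unfolding D_def by (auto intro: order_trans[rotated])
      then show ?thesis using l by blast
    qed simp
  qed
  then have "c 0 n \<le> card ({..i} \<union> (\<lambda>j. j + i + 1) ` D i n)"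
    unfolding c by (intro card_mono finite_UnI finite_imageI fin finite_atMost)
  also have "\<dots> \<le> card {..i} + card ((\<lambda>j. j + i + 1) ` D i n)" by (rule card_Un_le)
  also have "\<dots> \<le> (i + 1) + card (D i n)" using card_image_le[OF fin] by simp
  finally show "c 0 n \<le> c i n + (i + 1)" by (simp add: c)
  have "prod_encode (0, j) \<le> prod_encode (0, K)" if "j \<le> K" for j
    using tri[of j "K - j"] that by (simp add: prod_encode_def)
  then have "{..<K} \<subseteq> D 0 (s (prod_encode (0, K)))" by (auto simp: D_def le)
  then show "K \<le> c 0 (s (prod_encode (0, K)))"
    unfolding c using card_mono[OF fin] by (metis card_lessThan)
  have "j \<le> M" if "prod_encode (0, j) \<le> M" for j
    using le_prod_encode_2[of j 0] that by (rule order_trans)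
  then have "D 0 (s M) \<subseteq> {..M}" by (auto simp: D_def le)
  then have "card (D 0 (s M)) \<le> card {..M}" by (rule card_mono[OF finite_atMost])
  then show "c 0 (s M) \<le> M + 1" by (simp add: c)
qed

text \<open>The strict gap keeps the windows disjoint and leaves a filler at \<open>s m + k\<close>
  behind each block. That separator later rules out occurrences straddling the end of a placed
  block.\<close>

lemma exists_sequence_with_blocks:
  fixes s :: "nat \<Rightarrow> nat" and b :: "nat \<Rightarrow> nat \<Rightarrow> 'a"
  assumes gap: "\<And>m. s m + k < s (Suc m)"
  shows "\<exists>E. (\<forall>m. \<forall>j<k. E (s m + j) = b m j) \<and>
    (\<forall>n. (\<forall>m. \<forall>j<k. n \<noteq> s m + j) \<longrightarrow> E n = f n) \<and>
    (\<forall>m. E (s m + k) = f (s m + k))"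
proof -
  have mono: "strict_mono s" unfolding strict_mono_Suc_iff using gap by (meson add_lessD1)
  have sep: "s m + k < s m'" if "m < m'" for m m'
    using gap[of m] strict_mono_less_eq[OF mono, of "Suc m" m'] that by simp
  \<comment> \<open>Allowing \<open>j' = k\<close> covers the separators; \<open>j' < k\<close>
    shows that the choice in \<open>E\<close> below is unambiguous.\<close>
  have uniq: "m = m'" if "s m + j = s m' + j'" "j < k" "j' \<le> k" for m m' j j'
  proof (rule ccontr)
    assume "m \<noteq> m'"
    then show False using sep[of m m'] sep[of m' m] that by linarith
  qed
  define P where "P n mj \<longleftrightarrow> snd mj < k \<and> n = s (fst mj) + snd mj" for n mj
  define E where "E n = (if \<exists>mj. P n mj then (\<lambda>(m, j). b m j) (SOME mj. P n mj) else f n)" for n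
  have 1: "E (s m + j) = b m j" if "j < k" for m j
  proof -
    have P: "P (s m + j) (m, j)" using that by (simp add: P_def)
    then have "P (s m + j) (SOME mj. P (s m + j) mj)" by (rule someI)
    moreover have "mj = (m, j)" if "P (s m + j) mj" for mj
      using that uniq[of m j "fst mj" "snd mj"] \<open>j < k\<close> by (cases mj) (auto simp: P_def)
    ultimately have "(SOME mj. P (s m + j) mj) = (m, j)" by blast
    then show ?thesis using P by (auto simp: E_def)
  qed
  have 2: "E n = f n" if "\<forall>m. \<forall>j<k. n \<noteq> s m + j" for n
    using that by (auto simp: E_def P_def)
  have 3: "E (s m + k) = f (s m + k)" for m
  proof (rule 2, intro allI impI notI)
    fix m' j assume j: "j < k" "s m + k = s m' + j"
    then show False using uniq[of m' j m k] by simp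
  qed
  show ?thesis using 1 2 3 by blast
qed

lemma infinite_in_limitD:
  assumes "infinite_in_limit q" shows "\<exists>N. \<forall>n\<ge>N. K < q n"
  using assms[unfolded infinite_in_limit_def filterlim_at_top eventually_sequentially, rule_format, of "Suc K"]
  by (simp add: Suc_le_eq)

text \<open>\<open>g\<close> prescribes how sparse the placed blocks are. The reference count
  \<open>c\<close> counts placements of the block with index 0; every other block of length
  \<open>k\<close> follows it up to a constant of its own.\<close>

lemma exists_sparse_block_number:
  fixes g :: "nat \<Rightarrow> nat"
  assumes q: "basic_sequence q" and lim: "infinite_in_limit q" and k: "1 \<le> k"
  shows "\<exists>x c. filterlim c at_top sequentially \<and> (\<forall>M. \<exists>n\<ge>max M (g M). c n \<le> M + 1) \<and>
    (\<forall>B. length B = k \<longrightarrow>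
      (\<exists>C. \<forall>n. block_count q n B x \<le> c n + C \<and> c n \<le> block_count q n B x + C))"
proof -
  define \<beta> where "\<beta> = from_nat_into {B :: nat list. length B = k}"
  \<comment> \<open>The constant blocks already form an infinite set, so \<beta> enumerates all
    blocks bijectively.\<close>
  have "inj (\<lambda>n :: nat. replicate k n)" using k by (auto simp: inj_def)
  then have "infinite (range (\<lambda>n :: nat. replicate k n))" using finite_imageD by blast
  then have "infinite {B :: nat list. length B = k}" by (rule infinite_super[rotated]) auto
  then have bij: "bij_betw \<beta> UNIV {B. length B = k}"
    unfolding \<beta>_def by (intro bij_betw_from_nat_into) auto
  define b where "b m = \<beta> (fst (prod_decode m))" for m
  have len: "length (b m) = k" for m
    using bij unfolding b_def bij_betw_def by blast
  have "\<forall>m. \<exists>N. \<forall>n\<ge>N. sum_list (b m) < q n"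
    using infinite_in_limitD[OF lim] by blast
  \<comment> \<open>From \<open>h m\<close> on, the bases exceed every digit of \<open>b m\<close>,
    so the block may be written there.\<close>
  then obtain h where h: "\<And>m n. h m \<le> n \<Longrightarrow> sum_list (b m) < q n" by metis
  \<comment> \<open>The product gives the gaps and positivity; the sum pushes \<open>s m\<close>
    beyond \<open>g m\<close> and \<open>h m\<close>.\<close>
  define s where "s m = (k + 1) * (m + 1) + (\<Sum>i\<le>m. g i + h i)" for m
  have gap: "s m + k < s (Suc m)" for m by (simp add: s_def)
  have mono: "strict_mono s" unfolding strict_mono_Suc_iff using gap by (meson add_lessD1)
  have "g m + h m \<le> (\<Sum>i\<le>m. g i + h i)" for m
    by (rule member_le_sum[of m "{..m}" "\<lambda>i. g i + h i"]) auto
  then have s_ge: "g m + h m \<le> s m" for m unfolding s_def by (rule trans_le_add2)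
  have s_pos: "1 \<le> s m" for m by (simp add: s_def)
  have s_id: "m \<le> s m" for m by (rule strict_mono_imp_increasing[OF mono])
  \<comment> \<open>Unlike \<open>q n - 1\<close>, this filler keeps the expansion admissible, and
    it still tends to infinity.\<close>
  define f where "f n = q n - 2" for n
  obtain E0 where E0: "\<And>m j. j < k \<Longrightarrow> E0 (s m + j) = b m ! j"
    "\<And>n. (\<forall>m. \<forall>j<k. n \<noteq> s m + j) \<Longrightarrow> E0 n = f n" "\<And>m. E0 (s m + k) = f (s m + k)"
    using exists_sequence_with_blocks[where s = s and k = k, OF gap, of "\<lambda>m j. b m ! j" f] by metis
  define E where "E n = (if n = 0 then 0 else E0 n)" for n
  have E1: "E (s m + j) = b m ! j" if "j < k" for m j
    using E0(1)[OF that] s_pos[of m] by (simp add: E_def)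
  have E2: "E n = f n" if "\<forall>m. \<forall>j<k. n \<noteq> s m + j" "1 \<le> n" for n
    using E0(2)[OF that(1)] that(2) by (simp add: E_def)
  have E3: "E (s m + k) = f (s m + k)" for m
    using E0(3)[of m] s_pos[of m] by (simp add: E_def)
  have "E n \<le> q n - 1" if n: "1 \<le> n" for n
  proof (cases "\<exists>m. \<exists>j<k. n = s m + j")
    case True
    then obtain m j where mj: "j < k" "n = s m + j" by blast
    have "b m ! j \<le> sum_list (b m)" using mj len by (intro member_le_sum_list) auto
    also have "\<dots> < q n" using s_ge[of m] mj by (intro h) simp
    finally show ?thesis using E1[OF mj(1), of m] mj(2) by simp
  next
    case False
    then show ?thesis using E2[of n] n by (auto simp: f_def)
  qed
  moreover have "infinite {n. n \<ge> 1 \<and> E n \<noteq> q n - 1}"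
  proof -
    have "infinite (range (\<lambda>m. s m + k))"
    proof
      assume "finite (range (\<lambda>m. s m + k))"
      moreover have "inj (\<lambda>m. s m + k)" using strict_mono_eq[OF mono] by (simp add: inj_def)
      ultimately show False using finite_imageD by blast
    qed
    moreover have "range (\<lambda>m. s m + k) \<subseteq> {n. n \<ge> 1 \<and> E n \<noteq> q n - 1}"
    proof clarify
      fix m
      have "2 \<le> q (s m + k)" using q k by (simp add: basic_sequence_def)
      then show "1 \<le> s m + k \<and> E (s m + k) \<noteq> q (s m + k) - 1"
        using E3[of m] k by (simp add: f_def)
    qed
    ultimately show ?thesis by (rule infinite_super[rotated])
  qed
  ultimately obtain x where x: "cantor_digits q x = E"
    using exists_real_with_digits[OF q, of E] by (auto simp: E_def)
  define c where "c i n = card {m. fst (prod_decode m) = i \<and> s m \<le> n}" for i n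
  note c = card_diagonal_index_bounds[OF mono, folded c_def]
  have fin: "finite {m. fst (prod_decode m) = i \<and> s m \<le> n}" for i n
    using finite_le_strict_mono[OF mono inj_on_id2, of n] by (rule rev_finite_subset) auto
  have count: "\<exists>C. \<forall>n. block_count q n B x \<le> c 0 n + C \<and> c 0 n \<le> block_count q n B x + C"
    if B: "length B = k" for B
  proof -
    obtain i where i: "B = \<beta> i" using bij B unfolding bij_betw_def by blast
    have b_eq: "b m = B \<longleftrightarrow> fst (prod_decode m) = i" for m
      using bij unfolding b_def i bij_betw_def by (auto dest: injD)
    \<comment> \<open>Beyond \<open>T\<close> every filler exceeds all digits of
      \<open>B\<close>.\<close>
    obtain T where T: "\<And>n. T \<le> n \<Longrightarrow> sum_list B + 2 < q n"
      using infinite_in_limitD[OF lim] by blast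
    have filler: "E (p + j) \<noteq> f (p + j)" if "T \<le> p" "j < k" "E (p + j) = B ! j" for p j
    proof -
      have "B ! j \<le> sum_list B" using that B by (intro member_le_sum_list) auto
      then show ?thesis using that T[of "p + j"] by (simp add: f_def)
    qed
    define occ where "occ n = {p \<in> {1..n}. \<forall>j<k. E (p + j) = B ! j}" for n
    define pl where "pl n = s ` {m. fst (prod_decode m) = i \<and> s m \<le> n}" for n
    have card_occ: "block_count q n B x = card (occ n)" for n
      by (simp add: block_count_def occ_def x B)
    have card_pl: "card (pl n) = c i n" for n
      unfolding pl_def c_def by (rule card_image) (use strict_mono_eq[OF mono] in \<open>auto simp: inj_on_def\<close>)
    have sub1: "pl n \<subseteq> occ n" for n
      using s_pos E1 by (auto simp: pl_def occ_def b_eq[symmetric])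
    have sub2: "occ n \<subseteq> pl n \<union> {..T}" for n
    proof
      fix p assume p: "p \<in> occ n"
      then have pB: "E (p + j) = B ! j" if "j < k" for j using that by (simp add: occ_def)
      show "p \<in> pl n \<union> {..T}"
      proof (cases "p \<le> T")
        case False
        then have fil: "E (p + j) \<noteq> f (p + j)" if "j < k" for j using filler[of p j] that pB by simp
        \<comment> \<open>The first digit of an occurrence beyond \<open>T\<close> is no filler, so
          it belongs to a placed block.\<close>
        have "\<exists>m. \<exists>j<k. p = s m + j"
          using E2[of p] fil[of 0] k p by (auto simp: occ_def)
        then obtain m j where mj: "j < k" "p = s m + j" by blast
        have "j = 0"
        proof (rule ccontr)
          assume "j \<noteq> 0"
          \<comment> \<open>With a positive offset \<open>j\<close> the occurrence would reach the
            separator at \<open>s m + k\<close>, a filler.\<close>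
          then show False using fil[of "k - j"] E3[of m] mj by simp
        qed
        then have pm: "p = s m" using mj by simp
        have "b m = B"
          using len B E1[of _ m] pB unfolding pm by (intro nth_equalityI) auto
        then show ?thesis using p pm by (auto simp: pl_def occ_def b_eq)
      qed simp
    qed
    have fin_occ: "finite (occ n)" and fin_pl: "finite (pl n)" for n
      by (simp_all add: occ_def pl_def fin)
    \<comment> \<open>Up to \<open>T + 1\<close> occurrences start early; listing along diagonals
      costs at most \<open>i + 1\<close>.\<close>
    have "block_count q n B x \<le> c 0 n + (T + i + 1) \<and> c 0 n \<le> block_count q n B x + (T + i + 1)" for n
    proof
      have "card (occ n) \<le> card (pl n \<union> {..T})" using sub2 by (intro card_mono) (simp_all add: fin_pl)
      also have "\<dots> \<le> card (pl n) + card {..T}" by (rule card_Un_le)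
      finally show "block_count q n B x \<le> c 0 n + (T + i + 1)"
        using c(1)[of i n] by (simp add: card_occ card_pl)
      have "card (pl n) \<le> card (occ n)" by (rule card_mono[OF fin_occ sub1])
      then show "c 0 n \<le> block_count q n B x + (T + i + 1)"
        using c(2)[of n i] by (simp add: card_occ card_pl)
    qed
    then show ?thesis by blast
  qed
  have c_mono: "c 0 m \<le> c 0 n" if "m \<le> n" for m n
    unfolding c_def using that by (intro card_mono fin) auto
  have "filterlim (c 0) at_top sequentially"
    unfolding filterlim_at_top eventually_sequentially
  proof
    fix K
    show "\<exists>N. \<forall>n\<ge>N. K \<le> c 0 n" using c(3)[of K] c_mono order_trans by blast
  qed
  \<comment> \<open>The witness is \<open>s M\<close>: by then exactly \<open>M + 1\<close>
    placements have begun.\<close>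
  moreover have "\<exists>n\<ge>max M (g M). c 0 n \<le> M + 1" for M
    using c(4)[of M] s_ge[of M] s_id[of M] by (intro exI[of _ "s M"]) simp
  ultimately show ?thesis using count by blast
qed

section \<open>Comparison of counts and failure of normality\<close>

lemma ratio_tendsto_1_of_bounded_diff:
  fixes a c :: "nat \<Rightarrow> nat"
  assumes c: "filterlim c at_top sequentially" and a: "\<And>n. a n \<le> c n + C" "\<And>n. c n \<le> a n + C"
  shows "(\<lambda>n. real (a n) / real (c n)) \<longlonglongrightarrow> 1"
proof -
  have inf: "filterlim (\<lambda>n. real (c n)) at_top sequentially"
    by (rule filterlim_compose[OF filterlim_real_sequentially c])
  have "(\<lambda>n. (real (a n) - real (c n)) / real (c n)) \<longlonglongrightarrow> 0"
  proof (rule Lim_null_comparison)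
    show "(\<lambda>n. real C / real (c n)) \<longlonglongrightarrow> 0"
      by (rule tendsto_divide_0[OF tendsto_const filterlim_at_top_imp_at_infinity[OF inf]])
    have "\<bar>real (a n) - real (c n)\<bar> \<le> real C" for n
      using a(1)[of n] a(2)[of n] by linarith
    then show "\<forall>\<^sub>F n in sequentially. norm ((real (a n) - real (c n)) / real (c n)) \<le> real C / real (c n)"
      by (simp add: divide_right_mono)
  qed
  then have "(\<lambda>n. 1 + (real (a n) - real (c n)) / real (c n)) \<longlonglongrightarrow> 1 + 0"
    by (intro tendsto_add tendsto_const)
  moreover have "\<forall>\<^sub>F n in sequentially.
      1 + (real (a n) - real (c n)) / real (c n) = real (a n) / real (c n)"
    using filterlim_at_top_dense[THEN iffD1, OF inf, rule_format, of 0]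
    by eventually_elim (simp add: field_simps)
  ultimately show ?thesis using Lim_transform_eventually by force
qed

text \<open>The counts are unbounded, against a bounded \<open>Q_sum\<close>; if
  \<open>Q_sum\<close> is unbounded, \<open>g\<close> makes the counts lag behind it infinitely
  often.\<close>

lemma normal_set_neq_ratio_normal_set:
  assumes q: "basic_sequence q" and lim: "infinite_in_limit q" and k: "1 \<le> k"
  shows "normal_set k q \<noteq> ratio_normal_set k q"
proof -
  define bdd where "bdd \<longleftrightarrow> (\<exists>K. \<forall>n. Q_sum q k n \<le> K)"
  \<comment> \<open>Normality would give \<open>Q_sum\<close> at most twice the count, that is about
    \<open>2 * (M + 1)\<close> plus a constant; the factor 3 beats this for large
    \<open>M\<close>.\<close>
  have "\<forall>M :: nat. \<exists>N. \<not> bdd \<longrightarrow> 3 * (real M + 1) \<le> Q_sum q k N"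
    unfolding bdd_def by (meson linear)
  then obtain g where g: "\<And>M :: nat. \<not> bdd \<Longrightarrow> 3 * (real M + 1) \<le> Q_sum q k (g M)" by metis
  obtain x c where c: "filterlim c at_top sequentially" "\<And>M. \<exists>n\<ge>max M (g M). c n \<le> M + 1"
    and count: "\<And>B. length B = k \<Longrightarrow>
      \<exists>C. \<forall>n. block_count q n B x \<le> c n + C \<and> c n \<le> block_count q n B x + C"
    using exists_sparse_block_number[OF q lim k, of g] by metis
  have "x \<in> ratio_normal_set k q"
    unfolding ratio_normal_set_def
  proof (intro CollectI allI impI)
    fix B1 B2 :: "nat list" assume B: "length B1 = k" "length B2 = k"
    have *: "(\<lambda>n. real (block_count q n B x) / real (c n)) \<longlonglongrightarrow> 1" if B: "length B = k" for B
    proof -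
      obtain C where "\<And>n. block_count q n B x \<le> c n + C" "\<And>n. c n \<le> block_count q n B x + C"
        using count[OF B] by blast
      then show ?thesis by (rule ratio_tendsto_1_of_bounded_diff[OF c(1)])
    qed
    have "(\<lambda>n. (real (block_count q n B1 x) / real (c n)) / (real (block_count q n B2 x) / real (c n)))
        \<longlonglongrightarrow> 1 / 1"
      using B by (intro tendsto_divide *) auto
    moreover have "\<forall>\<^sub>F n in sequentially.
        (real (block_count q n B1 x) / real (c n)) / (real (block_count q n B2 x) / real (c n)) =
        real (block_count q n B1 x) / real (block_count q n B2 x)"
      using filterlim_at_top[THEN iffD1, OF c(1), rule_format, of 1]
      by eventually_elim simp
    ultimately show "(\<lambda>n. real (block_count q n B1 x) / real (block_count q n B2 x)) \<longlonglongrightarrow> 1"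
      using Lim_transform_eventually by force
  qed
  moreover have "x \<notin> normal_set k q"
  proof
    assume x: "x \<in> normal_set k q"
    define B where "B = replicate k (0 :: nat)"
    have "length B = k" by (simp add: B_def)
    then obtain C where C: "\<And>n. block_count q n B x \<le> c n + C" "\<And>n. c n \<le> block_count q n B x + C"
      using count by blast
    have l: "(\<lambda>n. real (block_count q n B x) / Q_sum q k n) \<longlonglongrightarrow> 1"
      using x \<open>length B = k\<close> by (simp add: normal_set_def)
    have "\<forall>\<^sub>F n in sequentially. 1 / 2 < real (block_count q n B x) / Q_sum q k n"
      "\<forall>\<^sub>F n in sequentially. real (block_count q n B x) / Q_sum q k n < 2"
      using order_tendstoD(1)[OF l, of "1/2"] order_tendstoD(2)[OF l, of 2] by simp_all
    then have "\<forall>\<^sub>F n in sequentially. Q_sum q k n \<le> 2 * real (block_count q n B x) \<and>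
        real (block_count q n B x) \<le> 2 * Q_sum q k n"
      using eventually_ge_at_top[of 1]
    proof eventually_elim
      case (elim n)
      then show ?case using Q_sum_pos[OF q, of n k] by (simp add: field_simps)
    qed
    then obtain n0 where n0: "\<And>n. n0 \<le> n \<Longrightarrow> Q_sum q k n \<le> 2 * real (block_count q n B x)"
      "\<And>n. n0 \<le> n \<Longrightarrow> real (block_count q n B x) \<le> 2 * Q_sum q k n"
      unfolding eventually_sequentially by blast
    show False
    proof (cases bdd)
      case True
      then obtain K where K: "\<And>n. Q_sum q k n \<le> K" by (auto simp: bdd_def)
      obtain L :: nat where L: "2 * K + real C < real L" using reals_Archimedean2 by blast
      have "\<forall>\<^sub>F n in sequentially. L \<le> c n" using c(1) by (simp add: filterlim_at_top)
      then obtain n1 where n1: "\<And>n. n1 \<le> n \<Longrightarrow> L \<le> c n" unfolding eventually_sequentially by blast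
      define n where "n = max n0 n1"
      have "real L \<le> real (block_count q n B x) + real C"
        using n1[of n] C(2)[of n] by (simp add: n_def)
      also have "\<dots> \<le> 2 * K + real C" using n0(2)[of n] K[of n] by (simp add: n_def)
      finally show False using L by simp
    next
      case False
      \<comment> \<open>\<open>n0\<close> brings \<open>n\<close> into the range of the estimates,
        and \<open>2 * C\<close> contradicts the resulting bound on \<open>M + 1\<close>.\<close>
      define M where "M = max n0 (2 * C)"
      obtain n where n: "max M (g M) \<le> n" "c n \<le> M + 1" using c(2) by blast
      have "3 * (real M + 1) \<le> Q_sum q k n"
        using g[OF False, of M] Q_sum_mono[of "g M" n q k] n(1) by simp
      also have "\<dots> \<le> 2 * real (block_count q n B x)" using n0(1)[of n] n(1) by (simp add: M_def)
      also have "\<dots> \<le> 2 * (real M + 1 + real C)" using C(1)[of n] n(2) by simp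
      finally have "real M + 1 \<le> 2 * real C" by simp
      moreover have "2 * real C \<le> real M" by (simp add: M_def)
      ultimately show False by simp
    qed
  qed
  ultimately show ?thesis by blast
qed

theorem theorem2p7:
  fixes q :: "nat \<Rightarrow> nat" and k :: nat
  assumes "basic_sequence q" and "k \<ge> 1"
  shows "first_category (ratio_normal_set k q) \<and>
         normal_set k q \<subseteq> ratio_normal_set k q \<and>
         (infinite_in_limit q \<longrightarrow> normal_set k q \<subset> ratio_normal_set k q) \<and>
         first_category (normal_set k q)"
  using ratio_normal_set_first_category[OF assms]
    normal_set_subset_ratio_normal_set[OF assms(1), of k]
    normal_set_neq_ratio_normal_set[OF assms(1) _ assms(2)] first_category_subset
  by (simp add: psubset_eq)

end
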